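(* Let $X$ be a set with exactly $3$ elements and let $n=6$, $N(6)=\{1,\dots,6\}$. Let $\mathcal{D}^{N(6)*}_{\text{Weak Condorcet}}$ be the set of all preference profiles $R_{N(6)}\in\mathcal{L}^{N(6)}$ at which there exists a unique weak-Condorcet winner, and let $f$ be the resolute choice function on $\mathcal{D}^{N(6)*}_{\text{Weak Condorcet}}$ such that for each $R_{N(6)}$ in this domain, $f(R_{N(6)})$ is the unique weak-Condorcet winner at $R_{N(6)}$. Then $f$ violates (i.e. does not satisfy) Global Independence of Irrelevant Alternatives (GIIA).
   Context: $X$ is the finite set of alternatives; $N(n)=\{1,\dots,n\}$ is the set of states of nature. A strict ranking on $X$ is a reflexive, complete, transitive and antisymmetric binary relation $R$ on $X$; $xRy$ means $(x,y)\in R$, and for $x\ne y$ it is read "$x$ is strictly preferred to $y$". $\mathcal{L}$ is the set of all strict rankings on $X$. For $R\in\mathcal{L}$ and $x\in X$, the rank of $x$ is $rk(x,R)=|\{y\in X: yRx\}|$ (so the best alternative has rank $1$). A preference profile is a function $R_{N(n)}=\langle R_i \mid i\in N(n)\rangle$ from $N(n)$ to $\mathcal{L}$; $\mathcal{L}^{N(n)}$ is the set of all preference profiles. $R_i|A$ denotes the restriction of $R_i$ to a subset $A\subset X$. A choice function (CF) on a non-empty set $\mathcal{D}\subset\mathcal{L}^{N(n)}$ is a function from $\mathcal{D}$ to the set of all non-empty subsets of $X$. A resolute choice function (RCF) is a singleton-valued choice function; one writes $f(R_{N(n)})=x$ instead of $f(R_{N(n)})=\{x\}$. An alternative $x\in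 X$ is a weak-Condorcet winner at $R_{N(n)}$ if for all $y\in X\setminus\{x\}$: $|\{j\in N(n): rk(x,R_j)<rk(y,R_j)\}|\ge \frac n2$. GIIA: a CF $f$ on $\mathcal{D}$ satisfies Global Independence of Irrelevant Alternatives if for all $R_{N(n)},R'_{N(n)}\in\mathcal{D}$ and all $x,y\in X$ with $x\neq y$: if $R_i|\{x,y\}=R'_i|\{x,y\}$ for all $i\in N(n)$, $x\in f(R_{N(n)})$ and $y\notin f(R_{N(n)})$, then $y\notin f(R'_{N(n)})$. *)

theory Defs
  imports Complex_Main "HOL-Library.FuncSet"
begin

text \<open>\<open>(x, y) \<in> R\<close> reads ``\<open>x\<close> is at least as good as \<open>y\<close>''. Being reflexive and total,
  \<^const>\<open>linear_order_on\<close> is complete in the weak sense.\<close>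

definition strict_rankings :: "'a set \<Rightarrow> 'a rel set" where
  "strict_rankings X = {R. linear_order_on X R}"

definition rk :: "'a set \<Rightarrow> 'a \<Rightarrow> 'a rel \<Rightarrow> nat" where
  "rk X x R = card {y \<in> X. (y, x) \<in> R}"

text \<open>States of nature are \<open>1, \<dots>, n\<close>; profiles are extensional, so that two profiles are equal
  iff they agree on these states.\<close>

definition profiles :: "'a set \<Rightarrow> nat \<Rightarrow> (nat \<Rightarrow> 'a rel) set" where
  "profiles X n = {1..n} \<rightarrow>\<^sub>E strict_rankings X"

definition restrict_rel :: "'a rel \<Rightarrow> 'a set \<Rightarrow> 'a rel" where
  "restrict_rel R A = R \<inter> (A \<times> A)"

definition choice_function ::
  "'a set \<Rightarrow> nat \<Rightarrow> (nat \<Rightarrow> 'a rel) set \<Rightarrow> ((nat \<Rightarrow> 'a rel) \<Rightarrow> 'a set) \<Rightarrow> bool" where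
  "choice_function X n D f \<longleftrightarrow>
     D \<noteq> {} \<and> D \<subseteq> profiles X n \<and> (\<forall>R\<in>D. f R \<noteq> {} \<and> f R \<subseteq> X)"

definition resolute_choice_function ::
  "'a set \<Rightarrow> nat \<Rightarrow> (nat \<Rightarrow> 'a rel) set \<Rightarrow> ((nat \<Rightarrow> 'a rel) \<Rightarrow> 'a set) \<Rightarrow> bool" where
  "resolute_choice_function X n D f \<longleftrightarrow>
     choice_function X n D f \<and> (\<forall>R\<in>D. is_singleton (f R))"

definition weak_condorcet_winner :: "'a set \<Rightarrow> nat \<Rightarrow> (nat \<Rightarrow> 'a rel) \<Rightarrow> 'a \<Rightarrow> bool" where
  "weak_condorcet_winner X n R x \<longleftrightarrow>
     x \<in> X \<and>
     (\<forall>y \<in> X - {x}. real (card {j \<in> {1..n}. rk X x (R j) < rk X y (R j)}) \<ge> real n / 2)"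

definition unique_weak_condorcet_domain :: "'a set \<Rightarrow> nat \<Rightarrow> (nat \<Rightarrow> 'a rel) set" where
  "unique_weak_condorcet_domain X n =
     {R \<in> profiles X n. \<exists>!x. weak_condorcet_winner X n R x}"

text \<open>Global Independence of Irrelevant Alternatives.\<close>

definition GIIA ::
  "'a set \<Rightarrow> nat \<Rightarrow> (nat \<Rightarrow> 'a rel) set \<Rightarrow> ((nat \<Rightarrow> 'a rel) \<Rightarrow> 'a set) \<Rightarrow> bool" where
  "GIIA X n D f \<longleftrightarrow>
     (\<forall>R\<in>D. \<forall>R'\<in>D. \<forall>x\<in>X. \<forall>y\<in>X. x \<noteq> y \<longrightarrow>
        (\<forall>i\<in>{1..n}. restrict_rel (R i) {x, y} = restrict_rel (R' i) {x, y}) \<longrightarrow>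
        x \<in> f R \<longrightarrow> y \<notin> f R \<longrightarrow> y \<notin> f R')"

text \<open>The choice function selecting the unique weak Condorcet winner exists: its domain contains
  every profile in which all states have the same ranking.\<close>

lemma unique_weak_condorcet_rule_exists:
  assumes "finite X" "X \<noteq> {}" "n > 0"
  shows "\<exists>f. resolute_choice_function X n (unique_weak_condorcet_domain X n) f \<and>
    (\<forall>R \<in> unique_weak_condorcet_domain X n. \<forall>x.
       weak_condorcet_winner X n R x \<longrightarrow> f R = {x})"
proof -
  obtain S where S: "well_order_on X S"
    using well_order_on by blast
  then have lin: "linear_order_on X S" and wf: "wf (S - Id)"
    by (auto simp: well_order_on_def)
  then have refl: "refl_on X S" and total: "total_on X S"
    by (auto simp: order_on_defs)
  obtain m where m: "m \<in> X" "\<And>y. (y, m) \<in> S - Id \<Longrightarrow> y \<notin> X"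
  proof -
    obtain a where "a \<in> X" using assms(2) by blast
    from wfE_min[OF wf this] that show ?thesis by blast
  qed
  have best: "(m, y) \<in> S" if "y \<in> X" for y
  proof (cases "y = m")
    case True
    then show ?thesis using refl_onD[OF refl m(1)] by simp
  next
    case False
    then have "(y, m) \<in> S \<or> (m, y) \<in> S"
      using total that m(1) by (auto simp: total_on_def)
    then show ?thesis using m(2)[of y] that False by auto
  qed
  have "{y \<in> X. (y, m) \<in> S} = {m}"
    using m best[OF m(1)] by blast
  then have rk_m: "rk X m S = 1"
    by (simp add: rk_def)
  have rk_y: "rk X m S < rk X y S" if "y \<in> X" "y \<noteq> m" for y
  proof -
    have "card {m, y} \<le> rk X y S"
      unfolding rk_def using that m(1) best[OF that(1)] refl_onD[OF refl that(1)] assms(1)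
      by (intro card_mono) auto
    with that rk_m show ?thesis by simp
  qed
  define P where "P = (\<lambda>i\<in>{1..n}. S)"
  have P: "P \<in> profiles X n"
    using lin by (auto simp: P_def profiles_def strict_rankings_def)
  have win: "weak_condorcet_winner X n P m"
  proof -
    have "{j \<in> {1..n}. rk X m (P j) < rk X y (P j)} = {1..n}" if "y \<in> X" "y \<noteq> m" for y
      using rk_y[OF that] by (auto simp: P_def)
    with m(1) show ?thesis
      by (auto simp: weak_condorcet_winner_def)
  qed
  have uniq: "x = m" if x: "weak_condorcet_winner X n P x" for x
  proof (rule ccontr)
    assume ne: "x \<noteq> m"
    have "x \<in> X" using x by (simp add: weak_condorcet_winner_def)
    then have "{j \<in> {1..n}. rk X x (P j) < rk X m (P j)} = {}"
      using rk_y[of x] ne by (auto simp: P_def)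
    moreover have "real (card {j \<in> {1..n}. rk X x (P j) < rk X m (P j)}) \<ge> real n / 2"
      using x ne m(1) by (auto simp: weak_condorcet_winner_def)
    ultimately have "real n / 2 \<le> 0"
      by (simp only: card.empty of_nat_0)
    then show False using assms(3) by simp
  qed
  have ne: "unique_weak_condorcet_domain X n \<noteq> {}"
    using P win uniq by (auto simp: unique_weak_condorcet_domain_def)
  define f where "f R = {x. weak_condorcet_winner X n R x}" for R
  have f: "f R = {x}"
    if "R \<in> unique_weak_condorcet_domain X n" "weak_condorcet_winner X n R x" for R x
    using that by (auto simp: f_def unique_weak_condorcet_domain_def)
  have single: "is_singleton (f R)" if "R \<in> unique_weak_condorcet_domain X n" for R
    using that f unfolding unique_weak_condorcet_domain_def is_singleton_def by blast
  have "resolute_choice_function X n (unique_weak_condorcet_domain X n) f"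
    unfolding resolute_choice_function_def choice_function_def
    using ne single
    by (auto simp: unique_weak_condorcet_domain_def f_def weak_condorcet_winner_def)
  with f show ?thesis by blast
qed

end

theory Submission
  imports Defs
begin

text \<open>Let \<open>X = {x, y, z}\<close>. In the first profile \<open>x\<close> ties with \<open>y\<close> and beats \<open>z\<close>, while \<open>z\<close> beats
  \<open>y\<close>: the rankings are \<open>xzy\<close> (three states), \<open>zyx\<close> (one state) and \<open>yxz\<close> (two states). Only \<open>x\<close> is
  then a weak Condorcet winner. Exchanging the roles of \<open>x\<close> and \<open>y\<close>, and placing the three
  states of \<open>yzx\<close> where the first profile ranks \<open>y\<close> above \<open>x\<close>, gives a profile at which only \<open>y\<close>
  wins although no state changes its ranking of \<open>x\<close> against \<open>y\<close>.\<close>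

definition ranking3 :: "'a \<Rightarrow> 'a \<Rightarrow> 'a \<Rightarrow> 'a rel" where
  "ranking3 p q r = {(p, p), (q, q), (r, r), (p, q), (p, r), (q, r)}"

lemma ranking3_strict_ranking:
  assumes "p \<noteq> q" "p \<noteq> r" "q \<noteq> r"
  shows "ranking3 p q r \<in> strict_rankings {p, q, r}"
  using assms unfolding ranking3_def strict_rankings_def order_on_defs
    refl_on_def trans_def antisym_def total_on_def
  by auto

lemma rk_ranking3:
  assumes "p \<noteq> q" "p \<noteq> r" "q \<noteq> r"
  shows "rk {p, q, r} p (ranking3 p q r) = 1"
    and "rk {p, q, r} q (ranking3 p q r) = 2"
    and "rk {p, q, r} r (ranking3 p q r) = 3"
proof -
  have "{v \<in> {p, q, r}. (v, p) \<in> ranking3 p q r} = {p}"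
    "{v \<in> {p, q, r}. (v, q) \<in> ranking3 p q r} = {p, q}"
    "{v \<in> {p, q, r}. (v, r) \<in> ranking3 p q r} = {p, q, r}"
    using assms by (auto simp: ranking3_def)
  then show "rk {p, q, r} p (ranking3 p q r) = 1"
    and "rk {p, q, r} q (ranking3 p q r) = 2"
    and "rk {p, q, r} r (ranking3 p q r) = 3"
    using assms by (simp_all add: rk_def)
qed

text \<open>For distinct alternatives and \<open>b\<close> outside \<open>A\<close>, the states in
  \<open>A\<close> are exactly those that rank \<open>x\<close> above \<open>y\<close>. Swapping
  \<open>x\<close> with \<open>y\<close> and complementing \<open>A\<close> therefore keeps every
  comparison of these two.\<close>

definition tie_profile :: "'a \<Rightarrow> 'a \<Rightarrow> 'a \<Rightarrow> nat set \<Rightarrow> nat \<Rightarrow> nat \<Rightarrow> 'a rel" where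
  "tie_profile x y z A b = (\<lambda>i\<in>{1..6}.
     if i \<in> A then ranking3 x z y else if i = b then ranking3 z y x else ranking3 y x z)"

lemma tie_profile_winner:
  assumes d: "x \<noteq> y" "x \<noteq> z" "y \<noteq> z"
    and A: "A \<subseteq> {1..6}" "card A = 3" and b: "b \<in> {1..6} - A"
  shows "tie_profile x y z A b \<in> unique_weak_condorcet_domain {x, y, z} 6"
    and "weak_condorcet_winner {x, y, z} 6 (tie_profile x y z A b) x"
proof -
  let ?X = "{x, y, z}" and ?P = "tie_profile x y z A b"
  let ?above = "\<lambda>u v. {j \<in> {1..6}. rk ?X u (?P j) < rk ?X v (?P j)}"
  have perm: "{x, z, y} = ?X" "{z, y, x} = ?X" "{y, x, z} = ?X" by auto
  \<comment> \<open>\<open>rk_ranking3\<close> lists the alternatives in ranking order;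
    \<open>perm\<close> brings all three instances to the common set \<open>?X\<close>.\<close>
  note xzy = rk_ranking3[of x z y, unfolded perm] and zyx = rk_ranking3[of z y x, unfolded perm]
    and yxz = rk_ranking3[of y x z, unfolded perm]
  note rks = xzy[OF d(2) d(1) d(3)[symmetric]] yxz[OF d(1)[symmetric] d(3) d(2)]
    zyx[OF d(3)[symmetric] d(2)[symmetric] d(1)[symmetric]]
  have fin: "finite A" using A(1) finite_subset by blast
  have "?above x y = A" "?above x z = {1..6} - {b}" "?above y z = {1..6} - (insert b A)"
    "?above z x = {b}"
    using A(1) b by (auto simp: tie_profile_def rks)
  then have card: "card (?above x y) = 3" "card (?above x z) = 5" "card (?above y z) = 2"
    "card (?above z x) = 1"
    using A b fin by (simp_all add: card_Diff_subset)
  have "ranking3 x z y \<in> strict_rankings ?X" "ranking3 z y x \<in> strict_rankings ?X"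
    "ranking3 y x z \<in> strict_rankings ?X"
    using d ranking3_strict_ranking[of x z y] ranking3_strict_ranking[of z y x]
      ranking3_strict_ranking[of y x z] by (simp_all add: perm)
  then have "?P \<in> profiles ?X 6"
    by (auto simp: profiles_def tie_profile_def)
  moreover show win: "weak_condorcet_winner ?X 6 ?P x"
    unfolding weak_condorcet_winner_def
  proof (intro conjI ballI)
    fix u assume "u \<in> ?X - {x}"
    then have "u = y \<or> u = z" by auto
    \<comment> \<open>The tie with \<open>y\<close> meets the bound 6 / 2 with equality.\<close>
    then have "card (?above x u) \<ge> 3"
      by (elim disjE; simp only: card)
    then show "real (card (?above x u)) \<ge> real 6 / 2" by linarith
  qed simp
  moreover have "u = x" if u: "weak_condorcet_winner ?X 6 ?P u" for u
  proof (rule ccontr)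
    assume "u \<noteq> x"
    moreover have "u \<in> ?X" using u by (simp add: weak_condorcet_winner_def)
    moreover have "real (card (?above u v)) \<ge> real 6 / 2" if "v \<in> ?X" "v \<noteq> u" for v
      using u that unfolding weak_condorcet_winner_def by blast
    \<comment> \<open>Each rival has an opponent that defeats it: \<open>y\<close> loses to
      \<open>z\<close> by 2 to 4, and \<open>z\<close> loses to \<open>x\<close> by 1 to 5.\<close>
    ultimately have "real (card (?above y z)) \<ge> real 6 / 2 \<or> real (card (?above z x)) \<ge> real 6 / 2"
      using d by blast
    then show False unfolding card by simp
  qed
  ultimately show "?P \<in> unique_weak_condorcet_domain ?X 6"
    unfolding unique_weak_condorcet_domain_def by blast
qed

theorem proposition2:
  fixes X :: "'a set"
    and f :: "(nat \<Rightarrow> 'a rel) \<Rightarrow> 'a set"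
  assumes "card X = 3"
    and "resolute_choice_function X 6 (unique_weak_condorcet_domain X 6) f"
    and "\<And>R x. R \<in> unique_weak_condorcet_domain X 6 \<Longrightarrow> weak_condorcet_winner X 6 R x \<Longrightarrow> f R = {x}"
  shows "\<not> GIIA X 6 (unique_weak_condorcet_domain X 6) f"
proof
  let ?D = "unique_weak_condorcet_domain X 6"
  assume giia: "GIIA X 6 ?D f"
  obtain x y z where X: "X = {x, y, z}" and d: "x \<noteq> y" "x \<noteq> z" "y \<noteq> z"
    using assms(1) by (auto simp: card_3_iff)
  have X': "X = {y, x, z}" using X by auto
  \<comment> \<open>The two sets are complementary; 4 and 1 are arbitrary states outside the
    respective set.\<close>
  let ?P = "tie_profile x y z {1, 2, 3} 4" and ?Q = "tie_profile y x z {4, 5, 6} 1"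
  have P: "?P \<in> ?D" "weak_condorcet_winner X 6 ?P x"
    unfolding X by (rule tie_profile_winner; use d in auto)+
  have Q: "?Q \<in> ?D" "weak_condorcet_winner X 6 ?Q y"
    unfolding X' by (rule tie_profile_winner; use d in auto)+
  have "restrict_rel (?P i) {x, y} = restrict_rel (?Q i) {x, y}" if "i \<in> {1..6}" for i
  proof -
    have "i \<in> {1, 2, 3} \<or> i \<in> {4, 5, 6}" using that by auto
    then show ?thesis
      using d by (auto simp: tie_profile_def restrict_rel_def ranking3_def)
  qed
  moreover have "f ?P = {x}" "f ?Q = {y}" using assms(3) P Q by blast+
  moreover have "x \<in> X" "y \<in> X" using X by auto
  \<comment> \<open>At \<open>?P\<close>, \<open>x\<close> is chosen and \<open>y\<close> is not, so
    GIIA would forbid choosing \<open>y\<close> at \<open>?Q\<close>.\<close>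
  ultimately show False
    using giia P(1) Q(1) d(1) unfolding GIIA_def by (metis singletonD singletonI)
qed

end
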